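(* There is a computable stable $2$-coloring $c:[\mathbb{N}]^2\to\{\text{BLUE},\text{RED}\}$ such that every path decomposition of $c$ computes the halting set $K=\{e : \varphi_e(e)\text{ halts}\}$; that is, if $(P_{\text{BLUE}},P_{\text{RED}})$ is any path decomposition for $c$, then $K\le_T (P_{\text{BLUE}},P_{\text{RED}})$.
   Context: For a coloring $c:[\mathbb{N}]^2\to r$ (with colors $0,\dots,r-1$), a (monochromatic) path of color $k$ is a finite or infinite list $a_0,a_1,\dots$ of distinct natural numbers such that $c(\{a_{i-1},a_i\})=k$ for every $i\ge 1$; the empty list and one-element lists count as paths of every color. A path decomposition for $c$ is a collection of $r$ paths $P_0,\dots,P_{r-1}$ such that $P_j$ is a path of color $j$ and every natural number appears on exactly one of the paths. A path is identified with the function from an initial segment of $\mathbb{N}$ to $\mathbb{N}$ listing its elements in order. A coloring $c$ is stable if for every $x$ the limit $\lim_y c(\{x,y\})$ exists. *)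

theory Defs
  imports Complex_Main "HOL-Library.Nat_Bijection" "HOL-Library.Ramsey"
begin

(* Kleene's schemes for the functions that are partial recursive in a set A, in their
   unary form: all functions are unary, and tuples of arguments are coded by the Cantor
   pairing function prod_encode.  Since pairing and the two projections are among the
   initial functions, closure under Pr, Co, Rec and Mu gives all partial recursive
   functions of any number of arguments.  Query asks the oracle. *)

datatype prog =
    Zero
  | Succ
  | First
  | Second
  | Query
  | Pr prog prog
  | Co prog prog
  | Rec prog prog
  | Mu prog

(* computes A p x y: with oracle A, program p halts on input x with output y. *)

inductive computes :: "nat set \<Rightarrow> prog \<Rightarrow> nat \<Rightarrow> nat \<Rightarrow> bool" for A where
  Zero: "computes A Zero x 0"
| Succ: "computes A Succ x (Suc x)"
| First: "computes A First (prod_encode (x, y)) x"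
| Second: "computes A Second (prod_encode (x, y)) y"
| Query: "computes A Query x (if x \<in> A then 1 else 0)"
| Pr: "computes A p x y \<Longrightarrow> computes A q x z \<Longrightarrow>
    computes A (Pr p q) x (prod_encode (y, z))"
| Co: "computes A q x y \<Longrightarrow> computes A p y z \<Longrightarrow> computes A (Co p q) x z"
| Rec_0: "computes A p a y \<Longrightarrow> computes A (Rec p q) (prod_encode (a, 0)) y"
| Rec_Suc: "computes A (Rec p q) (prod_encode (a, n)) y \<Longrightarrow>
    computes A q (prod_encode (a, prod_encode (n, y))) z \<Longrightarrow>
    computes A (Rec p q) (prod_encode (a, Suc n)) z"
| Mu: "computes A p (prod_encode (a, n)) 0 \<Longrightarrow>
    \<forall>m<n. \<exists>k. computes A p (prod_encode (a, m)) (Suc k) \<Longrightarrow>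
    computes A (Mu p) a n"

inductive_cases computes_ZeroE: "computes A Zero x y"
inductive_cases computes_SuccE: "computes A Succ x y"
inductive_cases computes_FirstE: "computes A First x y"
inductive_cases computes_SecondE: "computes A Second x y"
inductive_cases computes_QueryE: "computes A Query x y"
inductive_cases computes_PrE: "computes A (Pr p q) x y"
inductive_cases computes_CoE: "computes A (Co p q) x y"
inductive_cases computes_RecE: "computes A (Rec p q) x y"
inductive_cases computes_MuE: "computes A (Mu p) x y"

lemma computes_deterministic:
  "computes A p x y \<Longrightarrow> computes A p x z \<Longrightarrow> y = z"
proof (induction arbitrary: z rule: computes.induct)
  case (Zero x)
  then show ?case by (auto elim: computes_ZeroE)
next
  case (Succ x)
  then show ?case by (auto elim: computes_SuccE)
next
  case (First x y)
  then show ?case by (auto elim: computes_FirstE)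
next
  case (Second x y)
  then show ?case by (auto elim: computes_SecondE)
next
  case (Query x)
  then show ?case by (auto elim: computes_QueryE)
next
  case (Pr p x y q w)
  from Pr.prems show ?case by (rule computes_PrE) (use Pr.IH in blast)
next
  case (Co q x y p w)
  from Co.prems show ?case by (rule computes_CoE) (use Co.IH in blast)
next
  case (Rec_0 p a y q)
  from Rec_0.prems show ?case by (rule computes_RecE) (use Rec_0.IH in auto)
next
  case (Rec_Suc p q a n y w)
  from Rec_Suc.prems show ?case by (rule computes_RecE) (use Rec_Suc.IH in auto)
next
  case (Mu p a n)
  from Mu.prems show ?case
  proof (rule computes_MuE)
    assume z: "computes A p (prod_encode (a, z)) 0"
      and less: "\<forall>m<z. \<exists>k. computes A p (prod_encode (a, m)) (Suc k)"
    have "\<not> n < z" using less Mu.IH by blast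
    moreover have "\<not> z < n" using z Mu.IH by blast
    ultimately show "n = z" by simp
  qed
qed

primrec code :: "prog \<Rightarrow> nat" where
  "code Zero = prod_encode (0, 0)"
| "code Succ = prod_encode (1, 0)"
| "code First = prod_encode (2, 0)"
| "code Second = prod_encode (3, 0)"
| "code Query = prod_encode (4, 0)"
| "code (Pr p q) = prod_encode (5, prod_encode (code p, code q))"
| "code (Co p q) = prod_encode (6, prod_encode (code p, code q))"
| "code (Rec p q) = prod_encode (7, prod_encode (code p, code q))"
| "code (Mu p) = prod_encode (8, code p)"

lemma code_eq_iff: "code p = code q \<longleftrightarrow> p = q"
proof (induction p arbitrary: q)
  case Zero
  show ?case by (cases q) auto
next
  case Succ
  show ?case by (cases q) auto
next
  case First
  show ?case by (cases q) auto
next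
  case Second
  show ?case by (cases q) auto
next
  case Query
  show ?case by (cases q) auto
next
  case (Pr p1 p2)
  then show ?case by (cases q) auto
next
  case (Co p1 p2)
  then show ?case by (cases q) auto
next
  case (Rec p1 p2)
  then show ?case by (cases q) auto
next
  case (Mu p)
  then show ?case by (cases q) auto
qed

(* The graph of the e-th partial computable function; it is nowhere defined if e is not
   the code of a program. *)

definition phi :: "nat \<Rightarrow> nat \<Rightarrow> nat \<Rightarrow> bool" where
  "phi e x y \<longleftrightarrow> (\<exists>p. code p = e \<and> computes {} p x y)"

definition halting_set :: "nat set" where
  "halting_set = {e. \<exists>y. phi e e y}"

definition turing_reducible :: "nat set \<Rightarrow> nat set \<Rightarrow> bool" (infix \<open>\<le>\<^sub>T\<close> 50) where
  "B \<le>\<^sub>T A \<longleftrightarrow> (\<exists>p. \<forall>x. computes A p x (if x \<in> B then 1 else 0))"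

(* Colorings are functions on two-element sets; their values on other sets are
   irrelevant. *)

definition is_coloring :: "nat \<Rightarrow> (nat set \<Rightarrow> nat) \<Rightarrow> bool" where
  "is_coloring r c \<longleftrightarrow> c \<in> [UNIV]\<^bsup>2\<^esup> \<rightarrow> {..<r}"

definition computable_coloring :: "(nat set \<Rightarrow> nat) \<Rightarrow> bool" where
  "computable_coloring c \<longleftrightarrow>
    (\<exists>p. \<forall>x y. x \<noteq> y \<longrightarrow> computes {} p (prod_encode (x, y)) (c {x, y}))"

definition stable_coloring :: "(nat set \<Rightarrow> nat) \<Rightarrow> bool" where
  "stable_coloring c \<longleftrightarrow> (\<forall>x. \<exists>k. \<forall>\<^sub>F y in sequentially. c {x, y} = k)"

(* A path is a partial function whose domain is an initial segment of the natural
   numbers: finite (possibly empty), or everything. *)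

definition is_path :: "(nat set \<Rightarrow> nat) \<Rightarrow> nat \<Rightarrow> (nat \<rightharpoonup> nat) \<Rightarrow> bool" where
  "is_path c k P \<longleftrightarrow>
    (\<forall>i j. i \<le> j \<and> j \<in> dom P \<longrightarrow> i \<in> dom P) \<and>
    inj_on P (dom P) \<and>
    (\<forall>i x y. P i = Some x \<and> P (Suc i) = Some y \<longrightarrow> c {x, y} = k)"

definition path_decomposition ::
    "nat \<Rightarrow> (nat set \<Rightarrow> nat) \<Rightarrow> (nat \<Rightarrow> nat \<rightharpoonup> nat) \<Rightarrow> bool" where
  "path_decomposition r c P \<longleftrightarrow>
    (\<forall>j<r. is_path c j (P j)) \<and> (\<forall>x. \<exists>!j. j < r \<and> x \<in> ran (P j))"

(* The join of the graphs of P 0, ..., P (r - 1), as an oracle. *)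

definition join_graphs :: "nat \<Rightarrow> (nat \<Rightarrow> nat \<rightharpoonup> nat) \<Rightarrow> nat set" where
  "join_graphs r P = {prod_encode (j, prod_encode (i, x)) | j i x. j < r \<and> P j i = Some x}"

(* With two colors, 0 is BLUE and 1 is RED. *)

end

theory Submission
  imports Defs
begin

text \<open>Assign to each stage s a number rank s so that ranks tend to infinity and the element
  enumerated into K at stage s, if any, is rank s. A stage is true if no later stage has smaller
  rank. A true stage of rank above e decides whether e is in K, since e is not enumerated later.
  Vertices are spread over the stages, each stage receiving more vertices than all earlier ones
  together. An edge between stages s and t with s at most t is red iff s still looks true at t.
  The limit color of a vertex is then red iff its stage is true.

  Blue edges at a true stage lead only to earlier stages, so the blue path cannot cover such a
  stage, and hence the red path is infinite. The relation "s looks true at t" is a forest order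
  and red edges join comparable stages. So once all numbers up to x have been listed on the two
  paths, the red path remains forever on one side of the question whether the stage of x looks
  true. As it is infinite, its next vertex already tells whether that stage is true.\<close>

section \<open>Functions and predicates recursive in an oracle\<close>

abbreviation pfst :: "nat \<Rightarrow> nat" where "pfst z \<equiv> fst (prod_decode z)"
abbreviation psnd :: "nat \<Rightarrow> nat" where "psnd z \<equiv> snd (prod_decode z)"

definition recursive_in :: "nat set \<Rightarrow> (nat \<Rightarrow> nat) \<Rightarrow> bool" where
  "recursive_in A f \<longleftrightarrow> (\<exists>p. \<forall>x. computes A p x (f x))"

definition decidable_in :: "nat set \<Rightarrow> (nat \<Rightarrow> bool) \<Rightarrow> bool" where
  "decidable_in A P \<longleftrightarrow> recursive_in A (\<lambda>x. if P x then 1 else 0)"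

named_theorems recursive_intros

lemma computes_First: "computes A First z (pfst z)"
  using computes.First[of A "pfst z" "psnd z"] by simp

lemma computes_Second: "computes A Second z (psnd z)"
  using computes.Second[of A "pfst z" "psnd z"] by simp

lemma recursive_in_comp:
  assumes "recursive_in A f" "recursive_in A g"
  shows "recursive_in A (\<lambda>x. f (g x))"
  using assms unfolding recursive_in_def by (meson computes.Co)

lemma recursive_in_pair [recursive_intros]:
  assumes "recursive_in A f" "recursive_in A g"
  shows "recursive_in A (\<lambda>x. prod_encode (f x, g x))"
  using assms unfolding recursive_in_def by (meson computes.Pr)

lemma recursive_in_pfst [recursive_intros]:
  assumes "recursive_in A f"
  shows "recursive_in A (\<lambda>x. pfst (f x))"
  using assms unfolding recursive_in_def by (meson computes.Co computes_First)

lemma recursive_in_psnd [recursive_intros]: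
  assumes "recursive_in A f"
  shows "recursive_in A (\<lambda>x. psnd (f x))"
  using assms unfolding recursive_in_def by (meson computes.Co computes_Second)

lemma recursive_in_Suc [recursive_intros]:
  assumes "recursive_in A f"
  shows "recursive_in A (\<lambda>x. Suc (f x))"
  using assms unfolding recursive_in_def by (meson computes.Co computes.Succ)

lemma recursive_in_id [recursive_intros]: "recursive_in A (\<lambda>x. x)"
proof -
  have "computes A (Pr First Second) x x" for x
    using computes.Pr[OF computes_First computes_Second, of A x] by simp
  then show ?thesis unfolding recursive_in_def by blast
qed

lemma recursive_in_const [recursive_intros]: "recursive_in A (\<lambda>x. n)"
proof (induction n)
  case 0
  show ?case unfolding recursive_in_def using computes.Zero by blast
next
  case (Suc n)
  then show ?case by (rule recursive_in_Suc)
qed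

text \<open>The argument of the step function has the shape (a, (n, y)) that the scheme
  \<open>Rec\<close> passes to its second program. Stated through \<open>rec_nat\<close>, the scheme
  covers every primitive recursion with a parameter.\<close>

lemma recursive_in_rec_nat [recursive_intros]:
  assumes "recursive_in A f"
    and "recursive_in A (\<lambda>z. g (pfst z) (pfst (psnd z)) (psnd (psnd z)))"
    and "recursive_in A b"
  shows "recursive_in A (\<lambda>x. rec_nat (f x) (g x) (b x))"
proof -
  obtain p q where p: "\<And>x. computes A p x (f x)"
    and q: "\<And>z. computes A q z (g (pfst z) (pfst (psnd z)) (psnd (psnd z)))"
    using assms(1,2) unfolding recursive_in_def by blast
  have "computes A (Rec p q) (prod_encode (a, n)) (rec_nat (f a) (g a) n)" for a n
  proof (induction n)
    case 0
    show ?case using computes.Rec_0[OF p] by simp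
  next
    case (Suc n)
    show ?case
      using computes.Rec_Suc[OF Suc q] by simp
  qed
  then have "computes A (Rec p q) z (rec_nat (f (pfst z)) (g (pfst z)) (psnd z))" for z
    by (metis prod.collapse prod_decode_inverse)
  then have "recursive_in A (\<lambda>z. rec_nat (f (pfst z)) (g (pfst z)) (psnd z))"
    unfolding recursive_in_def by blast
  from recursive_in_comp[OF this recursive_in_pair[OF recursive_in_id assms(3)]]
  show ?thesis by simp
qed

lemma recursive_in_pred [recursive_intros]:
  assumes "recursive_in A f"
  shows "recursive_in A (\<lambda>x. f x - 1)"
proof -
  have "rec_nat 0 (\<lambda>n _. n) m = m - 1" for m :: nat by (cases m) auto
  moreover have "recursive_in A (\<lambda>x. rec_nat 0 (\<lambda>n _. n) (f x))"
    by (intro recursive_intros assms)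
  ultimately show ?thesis by simp
qed

lemma recursive_in_add [recursive_intros]:
  assumes "recursive_in A f" "recursive_in A g"
  shows "recursive_in A (\<lambda>x. f x + g x)"
proof -
  have "rec_nat m (\<lambda>_. Suc) n = m + n" for m n by (induction n) auto
  moreover have "recursive_in A (\<lambda>x. rec_nat (f x) (\<lambda>_. Suc) (g x))"
    by (intro recursive_intros assms)
  ultimately show ?thesis by simp
qed

lemma recursive_in_diff [recursive_intros]:
  assumes "recursive_in A f" "recursive_in A g"
  shows "recursive_in A (\<lambda>x. f x - g x)"
proof -
  have "rec_nat m (\<lambda>_ y. y - 1) n = m - n" for m n :: nat by (induction n) auto
  moreover have "recursive_in A (\<lambda>x. rec_nat (f x) (\<lambda>_ y. y - 1) (g x))"
    by (intro recursive_intros assms)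
  ultimately show ?thesis by simp
qed

lemma recursive_in_If [recursive_intros]:
  assumes "decidable_in A P" "recursive_in A f" "recursive_in A g"
  shows "recursive_in A (\<lambda>x. if P x then f x else g x)"
proof -
  \<comment> \<open>The case distinction is a recursion on the truth value: 0 leaves the base value
    \<open>g x\<close>, and 1 takes a single step, which yields \<open>f x\<close>.\<close>
  have "recursive_in A (\<lambda>x. rec_nat (g x) (\<lambda>_ _. f x) (if P x then 1 else 0))"
    using assms(1) unfolding decidable_in_def
    by (intro recursive_intros recursive_in_comp[OF assms(2)] assms)
  moreover have "rec_nat (g x) (\<lambda>_ _. f x) (if P x then 1 else 0) = (if P x then f x else g x)" for x
    by simp
  ultimately show ?thesis by simp
qed

lemma decidable_in_le [recursive_intros]:
  assumes "recursive_in A f" "recursive_in A g"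
  shows "decidable_in A (\<lambda>x. f x \<le> g x)"
proof -
  have "recursive_in A (\<lambda>x. 1 - (f x - g x))"
    by (intro recursive_intros assms)
  moreover have "1 - (f x - g x) = (if f x \<le> g x then 1 else 0)" for x by simp
  ultimately show ?thesis unfolding decidable_in_def by simp
qed

lemma decidable_in_less [recursive_intros]:
  assumes "recursive_in A f" "recursive_in A g"
  shows "decidable_in A (\<lambda>x. f x < g x)"
  using decidable_in_le[OF recursive_in_Suc[OF assms(1)] assms(2)] by (simp add: Suc_le_eq)

lemma decidable_in_conj [recursive_intros]:
  assumes "decidable_in A P" "decidable_in A Q"
  shows "decidable_in A (\<lambda>x. P x \<and> Q x)"
proof -
  have "recursive_in A (\<lambda>x. if P x then if Q x then 1 else 0 else 0)"
    by (intro recursive_intros assms)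
  then show ?thesis unfolding decidable_in_def by (rule back_subst[of "recursive_in A"]) auto
qed

lemma decidable_in_Not [recursive_intros]:
  assumes "decidable_in A P"
  shows "decidable_in A (\<lambda>x. \<not> P x)"
proof -
  have "recursive_in A (\<lambda>x. if P x then 0 else 1)"
    by (intro recursive_intros assms)
  then show ?thesis unfolding decidable_in_def by (rule back_subst[of "recursive_in A"]) auto
qed

lemma decidable_in_disj [recursive_intros]:
  assumes "decidable_in A P" "decidable_in A Q"
  shows "decidable_in A (\<lambda>x. P x \<or> Q x)"
proof -
  have "decidable_in A (\<lambda>x. \<not> (\<not> P x \<and> \<not> Q x))"
    by (intro recursive_intros assms)
  then show ?thesis by simp
qed

lemma decidable_in_imp [recursive_intros]:
  assumes "decidable_in A P" "decidable_in A Q"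
  shows "decidable_in A (\<lambda>x. P x \<longrightarrow> Q x)"
  unfolding imp_conv_disj by (intro recursive_intros assms)

lemma decidable_in_eq [recursive_intros]:
  assumes "recursive_in A f" "recursive_in A g"
  shows "decidable_in A (\<lambda>x. f x = g x)"
  unfolding eq_iff by (intro recursive_intros assms)

lemma decidable_in_comp:
  assumes "decidable_in A P" "recursive_in A f"
  shows "decidable_in A (\<lambda>x. P (f x))"
  using recursive_in_comp[OF assms(1)[unfolded decidable_in_def] assms(2)]
  unfolding decidable_in_def .

lemma decidable_in_oracle [recursive_intros]:
  assumes "recursive_in A f"
  shows "decidable_in A (\<lambda>x. f x \<in> A)"
  by (rule decidable_in_comp[OF _ assms])
    (unfold decidable_in_def recursive_in_def, blast intro: computes.Query)

lemma decidable_in_all_less [recursive_intros]: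
  assumes "recursive_in A b" "decidable_in A (\<lambda>z. P (pfst z) (psnd z))"
  shows "decidable_in A (\<lambda>x. \<forall>n<b x. P x n)"
proof -
  \<comment> \<open>The accumulator starts at 1, drops to 0 at the first counterexample and stays
    there.\<close>
  let ?h = "\<lambda>x n y. if P x n then y else (0::nat)"
  have P: "decidable_in A (\<lambda>z. P (f z) (g z))" if "recursive_in A f" "recursive_in A g" for f g
    using decidable_in_comp[OF assms(2) recursive_in_pair[OF that]] by simp
  have "recursive_in A (\<lambda>x. rec_nat 1 (?h x) (b x))"
    by (intro recursive_intros assms P)
  moreover have "rec_nat 1 (?h x) m = (if \<forall>n<m. P x n then 1 else 0)" for x m
    by (induction m) (auto simp: less_Suc_eq)
  ultimately show ?thesis unfolding decidable_in_def by simp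
qed

lemma decidable_in_ex_less [recursive_intros]:
  assumes "recursive_in A b" "decidable_in A (\<lambda>z. P (pfst z) (psnd z))"
  shows "decidable_in A (\<lambda>x. \<exists>n<b x. P x n)"
proof -
  have "decidable_in A (\<lambda>x. \<not> (\<forall>n<b x. \<not> P x n))"
    by (intro recursive_intros assms)
  then show ?thesis by simp
qed

lemma recursive_in_Least [recursive_intros]:
  assumes "decidable_in A (\<lambda>z. P (pfst z) (psnd z))" "\<And>x. \<exists>n. P x n"
  shows "recursive_in A (\<lambda>x. LEAST n. P x n)"
proof -
  \<comment> \<open>The truth values are swapped because \<open>Mu\<close> looks for a zero and
    demands positive values before it.\<close>
  have "recursive_in A (\<lambda>z. if P (pfst z) (psnd z) then 0 else 1)"
    by (intro recursive_intros assms)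
  then obtain p where p: "\<And>z. computes A p z (if P (pfst z) (psnd z) then 0 else 1)"
    unfolding recursive_in_def by blast
  have "computes A (Mu p) x (LEAST n. P x n)" for x
  proof (rule computes.Mu)
    show "computes A p (prod_encode (x, LEAST n. P x n)) 0"
      using p[of "prod_encode (x, LEAST n. P x n)"] LeastI_ex[OF assms(2)] by simp
    show "\<forall>m<LEAST n. P x n. \<exists>k. computes A p (prod_encode (x, m)) (Suc k)"
    proof (intro allI impI exI)
      fix m assume "m < (LEAST n. P x n)"
      then have "\<not> P x m" by (rule not_less_Least)
      then show "computes A p (prod_encode (x, m)) (Suc 0)"
        using p[of "prod_encode (x, m)"] by simp
    qed
  qed
  then show ?thesis unfolding recursive_in_def by blast
qed

section \<open>Finite lists coded by numbers\<close>

lemma prod_decode_0: "prod_decode 0 = (0, 0)"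
proof -
  have "prod_encode (0, 0) = 0" by (simp add: prod_encode_def)
  then show ?thesis using prod_encode_inverse[of "(0, 0)"] by simp
qed

text \<open>A nonempty list has code one plus the pair of head and tail, so the iterated function
  takes tails. It maps the code 0 of the empty list to 0, since 0 - 1 = 0 and 0 decodes to (0,
  0).\<close>

lemma list_encode_drop:
  "rec_nat (list_encode xs) (\<lambda>_ v. psnd (v - 1)) i = list_encode (drop i xs)"
proof (induction i)
  case (Suc i)
  have "psnd (list_encode ys - 1) = list_encode (tl ys)" for ys
    by (cases ys) (simp_all add: prod_decode_0)
  with Suc show ?case by (simp add: drop_Suc tl_drop)
qed simp

text \<open>This bound and the next one confine positions and entries of a coded list below its
  code, so that quantifiers over them become bounded.\<close>

lemma length_le_list_encode: "length xs \<le> list_encode xs"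
proof (induction xs)
  case (Cons a xs)
  then show ?case using le_prod_encode_2[of "list_encode xs" a] by simp
qed simp

lemma mem_less_list_encode: "x \<in> set xs \<Longrightarrow> x < list_encode xs"
proof (induction xs)
  case (Cons a xs)
  then show ?case
    using le_prod_encode_1[of a "list_encode xs"] le_prod_encode_2[of "list_encode xs" a] by auto
qed simp

lemma decidable_in_mem_list [recursive_intros]:
  assumes "recursive_in A f" "recursive_in A g"
  shows "decidable_in A (\<lambda>x. f x \<in> set (list_decode (g x)))"
proof -
  let ?D = "\<lambda>u i. rec_nat u (\<lambda>_ v. psnd (v - 1)) i"
  \<comment> \<open>The i-th tail is nonempty exactly if its code is positive, and then its head is
    the i-th entry.\<close>
  have *: "y \<in> set (list_decode u) \<longleftrightarrow> (\<exists>i<u. 0 < ?D u i \<and> pfst (?D u i - 1) = y)" for y u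
  proof -
    obtain xs where u: "u = list_encode xs" by (metis list_decode_inverse)
    have "0 < list_encode (drop i xs) \<and> pfst (list_encode (drop i xs) - 1) = y \<longleftrightarrow>
        i < length xs \<and> xs ! i = y" for i
      by (cases "i < length xs") (auto simp flip: Cons_nth_drop_Suc)
    moreover have "i < list_encode xs" if "i < length xs" for i
      using that length_le_list_encode[of xs] by simp
    ultimately show ?thesis
      unfolding u list_encode_drop list_encode_inverse in_set_conv_nth by blast
  qed
  show ?thesis unfolding * by (intro recursive_intros assms recursive_in_comp[OF assms(1)] recursive_in_comp[OF assms(2)])
qed

lemma decidable_in_Bex_list [recursive_intros]:
  assumes "recursive_in A g" "decidable_in A (\<lambda>z. P (pfst z) (psnd z))"
  shows "decidable_in A (\<lambda>x. \<exists>n\<in>set (list_decode (g x)). P x n)"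
proof -
  have "(\<exists>n\<in>set (list_decode u). Q n) \<longleftrightarrow> (\<exists>n<u. n \<in> set (list_decode u) \<and> Q n)" for u Q
    by (metis list_decode_inverse mem_less_list_encode)
  then show ?thesis
    by (simp only:) (intro recursive_intros assms recursive_in_comp[OF assms(1)])
qed

lemma decidable_in_Ball_list [recursive_intros]:
  assumes "recursive_in A g" "decidable_in A (\<lambda>z. P (pfst z) (psnd z))"
  shows "decidable_in A (\<lambda>x. \<forall>n\<in>set (list_decode (g x)). P x n)"
proof -
  have "decidable_in A (\<lambda>x. \<not> (\<exists>n\<in>set (list_decode (g x)). \<not> P x n))"
    by (intro recursive_intros assms)
  then show ?thesis by simp
qed

section \<open>The halting set is recursively enumerable\<close>

text \<open>A computation is witnessed by a finite set of triples (program, input, output), each of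
  which follows from others by a single scheme. No well-foundedness condition is needed: each
  scheme descends in the program or, for the recursion scheme, in the recursion argument.\<close>

abbreviation triple :: "nat \<Rightarrow> nat \<Rightarrow> nat \<Rightarrow> nat" where
  "triple p x y \<equiv> prod_encode (p, prod_encode (x, y))"

definition justified :: "nat set \<Rightarrow> nat \<Rightarrow> nat \<Rightarrow> nat \<Rightarrow> bool" where
  "justified S p x y \<longleftrightarrow>
    p = code Zero \<and> y = 0 \<or> p = code Succ \<and> y = Suc x \<or> p = code First \<and> y = pfst x \<or>
    p = code Second \<and> y = psnd x \<or> p = code Query \<and> y = 0 \<or>
    pfst p = 5 \<and> triple (pfst (psnd p)) x (pfst y) \<in> S \<and> triple (psnd (psnd p)) x (psnd y) \<in> S \<or>
    pfst p = 6 \<and> (\<exists>w. triple (psnd (psnd p)) x w \<in> S \<and> triple (pfst (psnd p)) w y \<in> S) \<or>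
    pfst p = 7 \<and> psnd x = 0 \<and> triple (pfst (psnd p)) (pfst x) y \<in> S \<or>
    pfst p = 7 \<and> 0 < psnd x \<and> (\<exists>w. triple p (prod_encode (pfst x, psnd x - 1)) w \<in> S \<and>
      triple (psnd (psnd p)) (triple (pfst x) (psnd x - 1) w) y \<in> S) \<or>
    pfst p = 8 \<and> triple (psnd p) (prod_encode (x, y)) 0 \<in> S \<and>
      (\<forall>m<y. \<exists>w. triple (psnd p) (prod_encode (x, m)) w \<in> S \<and> 0 < w)"

definition closed_trace :: "nat set \<Rightarrow> bool" where
  "closed_trace S \<longleftrightarrow> (\<forall>t\<in>S. justified S (pfst t) (pfst (psnd t)) (psnd (psnd t)))"

lemma closed_trace_triple:
  "closed_trace S \<Longrightarrow> triple p x y \<in> S \<Longrightarrow> justified S p x y"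
  unfolding closed_trace_def by fastforce

text \<open>The set \<open>S\<close> occurs only positively in \<open>justified\<close>.\<close>

lemma justified_mono: "justified S p x y \<Longrightarrow> S \<subseteq> T \<Longrightarrow> justified T p x y"
  unfolding justified_def by (elim disjE) (simp_all, (blast+)?)

lemma closed_trace_Union:
  assumes "\<And>S. S \<in> \<C> \<Longrightarrow> closed_trace S"
  shows "closed_trace (\<Union>\<C>)"
  unfolding closed_trace_def
proof
  fix t assume "t \<in> \<Union>\<C>"
  then obtain S where "S \<in> \<C>" "t \<in> S" by blast
  moreover from this assms have "justified S (pfst t) (pfst (psnd t)) (psnd (psnd t))"
    unfolding closed_trace_def by blast
  ultimately show "justified (\<Union>\<C>) (pfst t) (pfst (psnd t)) (psnd (psnd t))"
    by (blast intro: justified_mono)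
qed

lemma closed_trace_Un: "closed_trace S \<Longrightarrow> closed_trace T \<Longrightarrow> closed_trace (S \<union> T)"
  using closed_trace_Union[of "{S, T}"] by auto

lemma closed_trace_extend:
  assumes "finite S" "closed_trace S" "justified S p x y"
  shows "\<exists>T. finite T \<and> closed_trace T \<and> triple p x y \<in> T"
proof (intro exI conjI)
  let ?T = "insert (triple p x y) S"
  have "justified ?T (pfst t) (pfst (psnd t)) (psnd (psnd t))" if "t \<in> ?T" for t
  proof (rule justified_mono)
    show "justified S (pfst t) (pfst (psnd t)) (psnd (psnd t))"
    proof (cases "t \<in> S")
      case True
      with assms(2) show ?thesis by (simp add: closed_trace_def)
    next
      case False
      with that assms(3) show ?thesis by simp
    qed
  qed blast
  then show "closed_trace ?T" unfolding closed_trace_def by blast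
qed (use assms(1) in simp_all)

lemma computes_closed_trace:
  assumes "closed_trace S"
  shows "triple (code p) x y \<in> S \<Longrightarrow> computes {} p x y"
proof (induction p arbitrary: x y)
  case Zero
  then show ?case
    using closed_trace_triple[OF assms Zero] by (auto simp: justified_def intro: computes.Zero)
next
  case Succ
  then show ?case
    using closed_trace_triple[OF assms Succ] by (auto simp: justified_def intro: computes.Succ)
next
  case First
  then show ?case
    using closed_trace_triple[OF assms First] by (auto simp: justified_def intro: computes_First)
next
  case Second
  then show ?case
    using closed_trace_triple[OF assms Second] by (auto simp: justified_def intro: computes_Second)
next
  case Query
  then show ?case
    using closed_trace_triple[OF assms Query] computes.Query[of "{}" x]
    by (auto simp: justified_def)
next
  case (Pr p q)
  then show ?case
    using closed_trace_triple[OF assms Pr.prems] computes.Pr[of "{}" p x "pfst y" q "psnd y"]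
    by (auto simp: justified_def)
next
  case (Co p q)
  then show ?case
    using closed_trace_triple[OF assms Co.prems] by (fastforce simp: justified_def intro: computes.Co)
next
  case (Rec p q)
  \<comment> \<open>A triple for recursion at n + 1 rests on one for the same program at n, so
    induction on programs alone does not reach it.\<close>
  have "triple (code (Rec p q)) (prod_encode (a, n)) y \<in> S \<Longrightarrow>
      computes {} (Rec p q) (prod_encode (a, n)) y" for a n y
  proof (induction n arbitrary: y)
    case 0
    then show ?case
      using closed_trace_triple[OF assms 0] Rec.IH by (auto simp: justified_def intro: computes.Rec_0)
  next
    case (Suc n)
    from closed_trace_triple[OF assms Suc.prems] obtain w
      where "triple (code (Rec p q)) (prod_encode (a, n)) w \<in> S"
        "triple (code q) (triple a n w) y \<in> S"
      by (auto simp: justified_def)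
    then show ?case using Suc.IH Rec.IH by (blast intro: computes.Rec_Suc)
  qed
  from this[of "pfst x" "psnd x" y] Rec.prems show ?case by simp
next
  case (Mu p)
  have "triple (code p) (prod_encode (x, y)) 0 \<in> S"
    "\<forall>m<y. \<exists>w. triple (code p) (prod_encode (x, m)) w \<in> S \<and> 0 < w"
    using closed_trace_triple[OF assms Mu.prems] by (auto simp: justified_def)
  with Mu.IH show ?case by (metis computes.Mu gr0_implies_Suc)
qed

lemma closed_trace_exists:
  "computes {} p x y \<Longrightarrow> \<exists>S. finite S \<and> closed_trace S \<and> triple (code p) x y \<in> S"
proof (induction rule: computes.induct)
  case (Pr p x y q z)
  then obtain S T where "finite S" "closed_trace S" "triple (code p) x y \<in> S"
    "finite T" "closed_trace T" "triple (code q) x z \<in> T" by blast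
  then show ?case
    by (intro closed_trace_extend[of "S \<union> T"])
      (auto simp: justified_def intro: closed_trace_Un)
next
  case (Co q x y p z)
  then obtain S T where "finite S" "closed_trace S" "triple (code q) x y \<in> S"
    "finite T" "closed_trace T" "triple (code p) y z \<in> T" by blast
  then show ?case
    by (intro closed_trace_extend[of "S \<union> T"])
      (auto simp: justified_def intro: closed_trace_Un)
next
  case (Rec_0 p a y q)
  then obtain S where "finite S" "closed_trace S" "triple (code p) a y \<in> S" by blast
  then show ?case
    by (intro closed_trace_extend[of S]) (auto simp: justified_def)
next
  case (Rec_Suc p q a n y z)
  then obtain S T where "finite S" "closed_trace S"
    "triple (code (Rec p q)) (prod_encode (a, n)) y \<in> S"
    "finite T" "closed_trace T" "triple (code q) (triple a n y) z \<in> T" by blast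
  then show ?case
    by (intro closed_trace_extend[of "S \<union> T"])
      (auto simp: justified_def intro: closed_trace_Un)
next
  case (Mu p a n)
  then obtain S where S: "finite S" "closed_trace S" "triple (code p) (prod_encode (a, n)) 0 \<in> S"
    by blast
  \<comment> \<open>One trace is chosen for each of the finitely many failed candidates m < n; their
    union with the trace for n is still finite.\<close>
  from Mu.IH(2) have "\<forall>m\<in>{..<n}. \<exists>T. finite T \<and> closed_trace T \<and>
      (\<exists>w. triple (code p) (prod_encode (a, m)) w \<in> T \<and> 0 < w)"
    by (metis lessThan_iff zero_less_Suc)
  then obtain T where T: "\<And>m. m < n \<Longrightarrow> finite (T m) \<and> closed_trace (T m) \<and>
      (\<exists>w. triple (code p) (prod_encode (a, m)) w \<in> T m \<and> 0 < w)"
    by (metis lessThan_iff)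
  let ?U = "\<Union>(insert S (T ` {..<n}))"
  have "finite ?U" using S(1) T by auto
  moreover have "closed_trace ?U" using S(2) T by (intro closed_trace_Union) auto
  moreover have "justified ?U (code (Mu p)) a n"
    unfolding justified_def using S(3) T by simp blast
  ultimately show ?case
    by (rule closed_trace_extend)
\<comment> \<open>The remaining cases are the initial functions, which are justified over the empty
  trace.\<close>
qed (rule closed_trace_extend[of "{}"]; simp add: closed_trace_def justified_def)+

text \<open>This trades the unbounded search for an output for a search through the members of the
  trace, which makes \<open>closed_trace\<close> decidable on coded lists.\<close>

lemma Bex_triple:
  "(\<exists>w. triple p x w \<in> S \<and> R w) \<longleftrightarrow>
    (\<exists>t\<in>S. pfst t = p \<and> pfst (psnd t) = x \<and> R (psnd (psnd t)))"
proof
  assume "\<exists>t\<in>S. pfst t = p \<and> pfst (psnd t) = x \<and> R (psnd (psnd t))"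
  then obtain t where "t \<in> S" "pfst t = p" "pfst (psnd t) = x" "R (psnd (psnd t))" by blast
  then have "triple p x (psnd (psnd t)) \<in> S" by auto
  with \<open>R _\<close> show "\<exists>w. triple p x w \<in> S \<and> R w" by blast
qed force

lemma decidable_in_closed_trace [recursive_intros]:
  assumes "recursive_in A g"
  shows "decidable_in A (\<lambda>x. closed_trace (set (list_decode (g x))))"
  unfolding closed_trace_def justified_def Bex_triple
  by (intro recursive_intros assms recursive_in_comp[OF assms])

section \<open>Recognizing the codes of programs\<close>

text \<open>A closed trace does not force its first entries to be codes of programs: recursion at
  argument 0 never inspects the step program. This is a separate certificate, closed under passing
  to immediate subprograms.\<close>

definition closed_codes :: "nat set \<Rightarrow> bool" where
  "closed_codes S \<longleftrightarrow> (\<forall>c\<in>S.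
    c = code Zero \<or> c = code Succ \<or> c = code First \<or> c = code Second \<or> c = code Query \<or>
    (pfst c = 5 \<or> pfst c = 6 \<or> pfst c = 7) \<and> pfst (psnd c) \<in> S \<and> psnd (psnd c) \<in> S \<or>
    pfst c = 8 \<and> psnd c \<in> S)"

lemma decidable_in_closed_codes [recursive_intros]:
  assumes "recursive_in A g"
  shows "decidable_in A (\<lambda>x. closed_codes (set (list_decode (g x))))"
  unfolding closed_codes_def
  by (intro recursive_intros assms recursive_in_comp[OF assms])

text \<open>The code of (a, b) is \<open>triangle (a + b) + a\<close>, hence at least 2a + b.
  Compound programs have positive tags, so the descent to subprograms strictly decreases
  codes.\<close>

lemma psnd_less: "0 < pfst c \<Longrightarrow> psnd c < c"
proof -
  assume *: "0 < pfst c"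
  have "n \<le> triangle n" for n by (induction n) auto
  from this[of "pfst c + psnd c"]
  have "psnd c < prod_encode (pfst c, psnd c)"
    using * by (simp add: prod_encode_def split_beta)
  then show ?thesis by simp
qed

lemma closed_codes_imp_code:
  assumes "closed_codes S"
  shows "c \<in> S \<Longrightarrow> \<exists>p. c = code p"
proof (induction c rule: less_induct)
  case (less c)
  have c: "c = prod_encode (pfst c, psnd c)" by simp
  have le: "pfst (psnd c) \<le> psnd c" "psnd (psnd c) \<le> psnd c"
    by (metis le_prod_encode_1 prod.collapse prod_decode_inverse)
      (metis le_prod_encode_2 prod.collapse prod_decode_inverse)
  from less.prems assms consider
      "c = code Zero \<or> c = code Succ \<or> c = code First \<or> c = code Second \<or> c = code Query"
    | "pfst c = 5 \<or> pfst c = 6 \<or> pfst c = 7" "pfst (psnd c) \<in> S" "psnd (psnd c) \<in> S"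
    | "pfst c = 8" "psnd c \<in> S"
    unfolding closed_codes_def by blast
  then show ?case
  proof cases
    case 1
    then show ?thesis by blast
  next
    case 2
    then have "psnd c < c" by (intro psnd_less) auto
    with le less.IH 2(2,3) obtain p q where "pfst (psnd c) = code p" "psnd (psnd c) = code q"
      by (meson order_le_less_trans)
    then have "c = prod_encode (pfst c, prod_encode (code p, code q))" by (metis prod.collapse prod_decode_inverse)
    with 2(1) show ?thesis by (metis code.simps(6-8))
  next
    case 3
    then have "psnd c < c" by (intro psnd_less) auto
    with less.IH 3(2) obtain p where "psnd c = code p" by blast
    with 3(1) c show ?thesis by (metis code.simps(9))
  qed
qed

lemma closed_codes_exists: "\<exists>S. finite S \<and> closed_codes S \<and> code p \<in> S"
proof (intro exI conjI)
  \<comment> \<open>Subprograms have codes no larger than the whole program, so this finite set is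
    closed.\<close>
  let ?S = "{c \<in> range code. c \<le> code p}"
  have le: "a \<le> prod_encode (k, prod_encode (a, b))" "b \<le> prod_encode (k, prod_encode (a, b))"
    for k a b
    by (meson le_prod_encode_1 le_prod_encode_2 order_trans)+
  show "closed_codes ?S"
    unfolding closed_codes_def
  proof
    fix c assume "c \<in> ?S"
    then obtain q where c: "c = code q" "code q \<le> code p" by blast
    then show "c = code Zero \<or> c = code Succ \<or> c = code First \<or> c = code Second \<or> c = code Query \<or>
      (pfst c = 5 \<or> pfst c = 6 \<or> pfst c = 7) \<and> pfst (psnd c) \<in> ?S \<and> psnd (psnd c) \<in> ?S \<or>
      pfst c = 8 \<and> psnd c \<in> ?S"
      by (cases q) (auto intro: order_trans[OF le(1)] order_trans[OF le(2)]
        order_trans[OF le_prod_encode_2])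
  qed
qed auto

section \<open>An enumeration of the halting set\<close>

definition halting_witness :: "nat \<Rightarrow> nat \<Rightarrow> bool" where
  "halting_witness e u \<longleftrightarrow>
    closed_codes (set (list_decode (pfst u))) \<and> e \<in> set (list_decode (pfst u)) \<and>
    closed_trace (set (list_decode (psnd u))) \<and>
    (\<exists>t\<in>set (list_decode (psnd u)). pfst t = e \<and> pfst (psnd t) = e)"

lemma halting_set_iff_witness: "e \<in> halting_set \<longleftrightarrow> (\<exists>u. halting_witness e u)"
proof
  assume "e \<in> halting_set"
  then obtain p y where e: "code p = e" and "computes {} p e y"
    by (auto simp: halting_set_def phi_def)
  then obtain T where T: "finite T" "closed_trace T" "triple e e y \<in> T"
    using closed_trace_exists by blast
  obtain S where S: "finite S" "closed_codes S" "e \<in> S"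
    using closed_codes_exists e by blast
  obtain xs ys where "set xs = S" "set ys = T" using S(1) T(1) finite_list by metis
  with S T have "halting_witness e (prod_encode (list_encode xs, list_encode ys))"
    unfolding halting_witness_def by (auto intro!: bexI[of _ "triple e e y"])
  then show "\<exists>u. halting_witness e u" ..
next
  assume "\<exists>u. halting_witness e u"
  then obtain u t where u: "closed_codes (set (list_decode (pfst u)))"
    "e \<in> set (list_decode (pfst u))" "closed_trace (set (list_decode (psnd u)))"
    "t \<in> set (list_decode (psnd u))" "pfst t = e" "pfst (psnd t) = e"
    unfolding halting_witness_def by blast
  moreover have "triple (pfst t) (pfst (psnd t)) (psnd (psnd t)) = t" by simp
  ultimately have "triple e e (psnd (psnd t)) \<in> set (list_decode (psnd u))" by simp
  moreover from closed_codes_imp_code[OF u(1,2)] obtain p where "e = code p" ..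
  ultimately have "computes {} p e (psnd (psnd t))"
    using computes_closed_trace[OF u(3)] by blast
  with \<open>e = code p\<close> show "e \<in> halting_set"
    by (auto simp: halting_set_def phi_def)
qed

text \<open>A stage codes a number together with a candidate witness. Asking for the least witness
  lets each number be enumerated only once, so that every rank is taken by finitely many
  stages.\<close>

definition enumerates :: "nat \<Rightarrow> bool" where
  "enumerates s \<longleftrightarrow> halting_witness (pfst s) (psnd s) \<and> (\<forall>u<psnd s. \<not> halting_witness (pfst s) u)"

lemma decidable_in_enumerates [recursive_intros]:
  assumes "recursive_in A g"
  shows "decidable_in A (\<lambda>x. enumerates (g x))"
proof -
  have "decidable_in A enumerates"
    unfolding enumerates_def[abs_def] halting_witness_def by (intro recursive_intros)
  then show ?thesis using assms by (rule decidable_in_comp)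
qed

lemma halting_set_iff_enumerates: "e \<in> halting_set \<longleftrightarrow> (\<exists>s. enumerates s \<and> pfst s = e)"
proof
  assume "e \<in> halting_set"
  then have ex: "\<exists>u. halting_witness e u" by (simp add: halting_set_iff_witness)
  have "enumerates (prod_encode (e, LEAST u. halting_witness e u))"
    unfolding enumerates_def using LeastI_ex[OF ex] not_less_Least by auto
  then show "\<exists>s. enumerates s \<and> pfst s = e" by force
qed (auto simp: enumerates_def halting_set_iff_witness)

lemma inj_on_pfst_enumerates: "inj_on pfst {s. enumerates s}"
proof (rule inj_onI)
  fix s t assume *: "s \<in> {s. enumerates s}" "t \<in> {s. enumerates s}" "pfst s = pfst t"
  have "\<not> psnd s < psnd t" "\<not> psnd t < psnd s"
    using * by (simp_all add: enumerates_def) blast+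
  with *(3) have "prod_decode s = prod_decode t" by (simp add: prod_eq_iff)
  then show "s = t" by (metis prod_decode_inverse)
qed

section \<open>The coloring\<close>

text \<open>Away from the enumerating stages the rank is only required to tend to infinity.\<close>

definition rank :: "nat \<Rightarrow> nat" where
  "rank s = (if enumerates s then pfst s else s)"

definition looks_true :: "nat \<Rightarrow> nat \<Rightarrow> bool" where
  "looks_true s t \<longleftrightarrow> (\<forall>u. s < u \<and> u \<le> t \<longrightarrow> rank s \<le> rank u)"

text \<open>A variant of Dekker's nondeficiency stages of an enumeration.\<close>

definition true_stage :: "nat \<Rightarrow> bool" where
  "true_stage s \<longleftrightarrow> (\<forall>u>s. rank s \<le> rank u)"

text \<open>Stage 0 holds the vertex 0 alone, and stage n + 1 holds the 2 * 3^n numbers from 3^n up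
  to 3^(n+1) - 1, against 3^n numbers in all earlier stages.\<close>

definition stage :: "nat \<Rightarrow> nat" where
  "stage x = (LEAST n. x < 3 ^ n)"

text \<open>Minimum and maximum make the color symmetric. Edges inside one stage are red, as a stage
  vacuously looks true at itself.\<close>

definition edge_color :: "nat \<Rightarrow> nat \<Rightarrow> nat" where
  "edge_color x y =
    (if looks_true (min (stage x) (stage y)) (max (stage x) (stage y)) then 1 else 0)"

definition coloring :: "nat set \<Rightarrow> nat" where
  "coloring S = edge_color (Min S) (Max S)"

lemma edge_color_commute: "edge_color x y = edge_color y x"
  by (simp add: edge_color_def min.commute max.commute)

lemma coloring_edge: "coloring {x, y} = edge_color x y"
  using edge_color_commute[of x y] by (cases "x \<le> y") (auto simp: coloring_def)

section \<open>Computability and stability of the coloring\<close>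

lemma recursive_in_rank [recursive_intros]:
  assumes "recursive_in A f"
  shows "recursive_in A (\<lambda>x. rank (f x))"
  unfolding rank_def by (intro recursive_intros assms)

lemma decidable_in_looks_true [recursive_intros]:
  assumes "recursive_in A f" "recursive_in A g"
  shows "decidable_in A (\<lambda>x. looks_true (f x) (g x))"
proof -
  have "looks_true s t \<longleftrightarrow> (\<forall>u<Suc t. s < u \<longrightarrow> rank s \<le> rank u)" for s t
    by (auto simp: looks_true_def less_Suc_eq_le)
  then show ?thesis
    by (simp only:) (intro recursive_intros assms recursive_in_comp[OF assms(1)])
qed

lemma less_power3: "n < 3 ^ n" for n :: nat
  by (induction n) auto

lemma recursive_in_stage [recursive_intros]:
  assumes "recursive_in A f"
  shows "recursive_in A (\<lambda>x. stage (f x))"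
proof -
  have pow: "rec_nat 1 (\<lambda>_ y. y + y + y) n = (3::nat) ^ n" for n by (induction n) auto
  have "recursive_in A (\<lambda>x. LEAST n. x < rec_nat 1 (\<lambda>_ y. y + y + y) n)"
    by (rule recursive_in_Least, intro recursive_intros) (unfold pow, blast intro: less_power3)
  then have "recursive_in A stage" unfolding pow stage_def[symmetric] .
  then show ?thesis using assms by (rule recursive_in_comp)
qed

lemma stage_le_iff: "stage x \<le> n \<longleftrightarrow> x < 3 ^ n"
proof
  have "x < 3 ^ stage x" unfolding stage_def by (rule LeastI[of _ x], rule less_power3)
  moreover assume "stage x \<le> n"
  ultimately show "x < 3 ^ n"
    by (meson less_le_trans one_le_numeral power_increasing)
qed (auto simp: stage_def intro: Least_le)

lemma stage_mono: "x \<le> y \<Longrightarrow> stage x \<le> stage y"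
  using stage_le_iff[of y "stage y"] stage_le_iff[of x "stage y"] by simp

lemma stage_power: "stage (3 ^ n) = Suc n"
  using stage_le_iff[of "3 ^ n" n] stage_le_iff[of "3 ^ n" "Suc n"] by simp

lemma computable_coloring_coloring: "computable_coloring coloring"
proof -
  have "recursive_in {} (\<lambda>z. edge_color (pfst z) (psnd z))"
    unfolding edge_color_def min_def max_def by (intro recursive_intros)
  then obtain p where "\<And>z. computes {} p z (edge_color (pfst z) (psnd z))"
    unfolding recursive_in_def by blast
  then have "computes {} p (prod_encode (x, y)) (edge_color x y)" for x y
    by (metis fst_conv prod_encode_inverse snd_conv)
  then show ?thesis
    unfolding computable_coloring_def coloring_edge by blast
qed

lemma stable_coloring_coloring: "stable_coloring coloring"
  unfolding stable_coloring_def coloring_edge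
proof
  fix x
  show "\<exists>k. \<forall>\<^sub>F y in sequentially. edge_color x y = k"
  proof (cases "true_stage (stage x)")
    case True
    then have "edge_color x y = 1" if "x \<le> y" for y
      using stage_mono[OF that] by (auto simp: edge_color_def looks_true_def true_stage_def)
    then show ?thesis by (auto simp: eventually_sequentially)
  next
    case False
    \<comment> \<open>The stage \<open>u\<close> refutes the truth of the stage of x, and every
      vertex from 3^u on lies in a stage beyond \<open>u\<close>.\<close>
    then obtain u where u: "stage x < u" "rank u < rank (stage x)"
      by (auto simp: true_stage_def not_le)
    have "edge_color x y = 0" if "3 ^ u \<le> y" for y
    proof -
      have "u < stage y" using stage_mono[OF that] by (simp add: stage_power)
      with u show ?thesis by (auto simp: edge_color_def looks_true_def not_le)
    qed
    then show ?thesis by (auto simp: eventually_sequentially)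
  qed
qed

lemma is_coloring_coloring: "is_coloring 2 coloring"
  by (auto simp: is_coloring_def coloring_def edge_color_def)

section \<open>Ranks and true stages\<close>

text \<open>A stage of rank at most e is itself at most e or enumerates a number at most e, and each
  number is enumerated at most once.\<close>

lemma finite_rank_le: "finite {s. rank s \<le> e}"
proof (rule finite_subset)
  show "{s. rank s \<le> e} \<subseteq> {..e} \<union> (pfst -` {..e} \<inter> {s. enumerates s})"
    by (auto simp: rank_def split: if_splits)
  show "finite ({..e} \<union> (pfst -` {..e} \<inter> {s. enumerates s}))"
    using finite_vimage_IntI[OF finite_atMost inj_on_pfst_enumerates] by simp
qed

lemma true_stage_exists: "\<exists>s\<ge>m. true_stage s \<and> e < rank s"
proof -
  obtain b where b: "\<And>s. rank s \<le> e \<Longrightarrow> s < b"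
    using finite_rank_le[of e] by (auto simp: finite_nat_set_iff_bounded)
  \<comment> \<open>A stage of least rank among all stages from \<open>max m b\<close> on is true,
    and beyond \<open>b\<close> all ranks exceed e.\<close>
  obtain s where s: "s \<ge> max m b" "\<And>u. u \<ge> max m b \<Longrightarrow> rank s \<le> rank u"
    using ex_has_least_nat[of "\<lambda>s. s \<ge> max m b" "max m b" rank] by auto
  then have "true_stage s" unfolding true_stage_def by simp
  moreover have "e < rank s" using b[of s] s(1) by (meson max.boundedE not_le)
  ultimately show ?thesis using s(1) by auto
qed

lemma halting_set_iff_true_stage:
  assumes "true_stage s" "e < rank s"
  shows "e \<in> halting_set \<longleftrightarrow> (\<exists>u<Suc s. enumerates u \<and> pfst u = e)"
proof
  assume "e \<in> halting_set"
  then obtain u where u: "enumerates u" "pfst u = e" by (auto simp: halting_set_iff_enumerates)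
  then have "rank u = e" by (simp add: rank_def)
  with assms have "\<not> s < u" by (auto simp: true_stage_def)
  then have "u < Suc s" by simp
  with u show "\<exists>u<Suc s. enumerates u \<and> pfst u = e" by blast
qed (auto simp: halting_set_iff_enumerates)

section \<open>Path decompositions of the coloring\<close>

lemma dom_infinite_path:
  assumes "is_path c k P" "infinite (ran P)"
  shows "dom P = UNIV"
proof -
  have down: "i \<in> dom P" if "i \<le> j" "j \<in> dom P" for i j
    using assms(1) that unfolding is_path_def by blast
  have "infinite (dom P)"
    using assms(2) finite_ran by blast
  then have "\<exists>j>i. j \<in> dom P" for i by (simp add: infinite_nat_iff_unbounded)
  with down show ?thesis by (metis UNIV_eq_I less_imp_le)
qed

text \<open>On a blue path, every vertex of a true stage is followed by a vertex of an earlier stage.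
  As a stage has more vertices than all earlier stages together, a blue path cannot contain all
  vertices of a true stage.\<close>

lemma infinite_red:
  assumes "path_decomposition 2 coloring P"
  shows "infinite (ran (P 1))"
proof
  assume fin: "finite (ran (P 1))"
  have blue: "is_path coloring 0 (P 0)"
    and cover: "x \<in> ran (P 0) \<or> x \<in> ran (P 1)" for x
    using assms unfolding path_decomposition_def by (auto simp: less_2_cases_iff)
  obtain m where m: "\<And>x. x \<in> ran (P 1) \<Longrightarrow> x < m"
    using fin by (auto simp: finite_nat_set_iff_bounded)
  have "UNIV = ran (P 0) \<union> ran (P 1)" using cover by blast
  then have "infinite (ran (P 0))" using fin by (metis finite_Un infinite_UNIV_nat)
  with blue have dom: "dom (P 0) = UNIV" by (rule dom_infinite_path)
  \<comment> \<open>The bound makes s a successor n + 1 with m at most 3^n, so stage s lies past all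
    red vertices and must be covered by the blue path.\<close>
  obtain s where s: "true_stage s" "s \<ge> Suc m" using true_stage_exists by blast
  then obtain n where n: "s = Suc n" by (metis Suc_le_D)
  have "m \<le> 3 ^ n"
    using s(2) n less_power3[of n] by simp
  let ?B = "{3 ^ n..<3 ^ s :: nat}"
  have "\<exists>i z. P 0 i = Some x \<and> P 0 (Suc i) = Some z \<and> z < 3 ^ n" if x: "x \<in> ?B" for x
  proof -
    have "x \<notin> ran (P 1)" using m[of x] x \<open>m \<le> 3 ^ n\<close> by auto
    with cover obtain i where i: "P 0 i = Some x" by (auto simp: ran_def)
    obtain z where z: "P 0 (Suc i) = Some z" using dom by (metis UNIV_I domD)
    have "edge_color x z = 0" using blue i z unfolding is_path_def coloring_edge[symmetric] by blast
    moreover have "stage x = s"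
      using stage_le_iff[of x n] stage_le_iff[of x s] x n by auto
    \<comment> \<open>A true stage looks true at itself and at all later stages, so a blue edge can
      only lead to an earlier one.\<close>
    ultimately have "stage z < s"
      using s(1) by (auto simp: edge_color_def looks_true_def true_stage_def min_def max_def
        split: if_splits)
    then have "z < 3 ^ n" using n by (simp add: less_Suc_eq_le stage_le_iff)
    with i z show ?thesis by blast
  qed
  then obtain i z where iz: "\<And>x. x \<in> ?B \<Longrightarrow> P 0 (i x) = Some x \<and> P 0 (Suc (i x)) = Some (z x) \<and> z x < 3 ^ n"
    by metis
  have "inj_on z ?B"
  proof (rule inj_onI)
    fix x y assume xy: "x \<in> ?B" "y \<in> ?B" "z x = z y"
    have "inj_on (P 0) (dom (P 0))" using blue unfolding is_path_def by blast
    moreover have "P 0 (Suc (i x)) = P 0 (Suc (i y))" using iz xy by metis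
    ultimately have "Suc (i x) = Suc (i y)" unfolding dom by (metis UNIV_I inj_onD)
    then show "x = y" using iz xy by (metis nat.inject option.inject)
  qed
  moreover have "z ` ?B \<subseteq> {..<3 ^ n}" using iz by auto
  ultimately have "card ?B \<le> card {..<3 ^ n :: nat}" by (metis card_inj_on_le finite_lessThan)
  \<comment> \<open>The set \<open>?B\<close> has 3 * 3^n - 3^n elements, but successors on the path
    embed it into 3^n numbers.\<close>
  then have "(3::nat) * 3 ^ n \<le> 2 * 3 ^ n" using n by simp
  then show False by simp
qed

text \<open>Towards a later stage, the red edge says that the stage of y still looks true there, and
  looking true is transitive. Towards an earlier stage, there are fewer stages to compare
  with.\<close>

lemma looks_true_red_edge:
  assumes "x \<le> y" "x \<le> z" "looks_true (stage x) (stage y)" "edge_color y z = 1"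
  shows "looks_true (stage x) (stage z)"
proof (cases "stage y \<le> stage z")
  case True
  then have "looks_true (stage y) (stage z)"
    using assms(4) by (simp add: edge_color_def split: if_splits)
  with assms(3) stage_mono[OF assms(1)] show ?thesis
    unfolding looks_true_def by (metis le_less_linear le_trans le_neq_implies_less order_refl)
next
  case False
  with assms(3) show ?thesis by (auto simp: looks_true_def)
qed

text \<open>Once all numbers up to x have been listed, the red path stays above x, and along its
  edges it cannot change whether the stage of x looks true.\<close>

lemma true_stage_iff_red:
  assumes P: "path_decomposition 2 coloring P"
    and listed: "\<forall>y\<le>x. \<exists>i\<le>N. P 0 i = Some y \<or> P 1 i = Some y"
    and a: "P 1 (Suc N) = Some a"
  shows "true_stage (stage x) \<longleftrightarrow> looks_true (stage x) (stage a)"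
proof
  assume *: "looks_true (stage x) (stage a)"
  have red: "is_path coloring 1 (P 1)"
    and disj: "y \<in> ran (P 0) \<Longrightarrow> y \<notin> ran (P 1)" for y
    using P unfolding path_decomposition_def by (auto simp: less_2_cases_iff)
  have inj: "inj_on (P 1) (dom (P 1))" using red unfolding is_path_def by blast
  have dom: "dom (P 1) = UNIV" using red infinite_red[OF P] by (rule dom_infinite_path)
  define q where "q i = the (P 1 i)" for i
  have q: "P 1 i = Some (q i)" for i
  proof -
    have "i \<in> dom (P 1)" unfolding dom by (rule UNIV_I)
    then show ?thesis by (auto simp: q_def)
  qed
  have inj_q: "i = j" if "q i = q j" for i j
    using inj_onD[OF inj, of i j] that q[of i] q[of j] unfolding dom by simp
  \<comment> \<open>Numbers up to x already occupy positions up to N; as the paths are disjoint and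
    injective, they cannot recur on the red path.\<close>
  have above: "x < q i" if "N < i" for i
  proof (rule ccontr)
    assume "\<not> x < q i"
    then have "q i \<le> x" by simp
    with listed obtain j where "j \<le> N" "P 0 j = Some (q i) \<or> P 1 j = Some (q i)"
      by blast
    moreover have "P 0 j \<noteq> Some (q i)" using disj[of "q i"] q[of i] by (blast intro: ranI)
    ultimately have "q j = q i" using q[of j] by simp
    then have "j = i" by (rule inj_q)
    with \<open>j \<le> N\<close> that show False by simp
  qed
  have looks: "looks_true (stage x) (stage (q (Suc N + i)))" for i
  proof (induction i)
    case 0
    show ?case using * a by (simp add: q_def)
  next
    case (Suc i)
    have "edge_color (q (Suc N + i)) (q (Suc N + Suc i)) = 1"
      using red q[of "Suc N + i"] q[of "Suc N + Suc i"]
      unfolding is_path_def coloring_edge[symmetric] add_Suc_right by blast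
    moreover have "x \<le> q (Suc N + i)" "x \<le> q (Suc N + Suc i)"
      by (intro less_imp_le above; simp)+
    ultimately show ?case using looks_true_red_edge Suc by blast
  qed
  show "true_stage (stage x)"
    unfolding true_stage_def
  proof (intro allI impI)
    fix u assume "stage x < u"
    \<comment> \<open>The red path visits arbitrarily late stages, and looking true at a stage from
      \<open>u\<close> on already bounds the rank of \<open>u\<close>.\<close>
    have "inj (\<lambda>i. q (Suc N + i))" by (rule injI, drule inj_q) simp
    then have "infinite (range (\<lambda>i. q (Suc N + i)))" by (rule range_inj_infinite)
    then obtain i where "3 ^ u \<le> q (Suc N + i)"
      unfolding infinite_nat_iff_unbounded_le by blast
    then have "u \<le> stage (q (Suc N + i))"
      using stage_mono[of "3 ^ u" "q (Suc N + i)"] by (simp add: stage_power)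
    with looks[of i] \<open>stage x < u\<close> show "rank (stage x) \<le> rank u"
      by (auto simp: looks_true_def)
  qed
qed (auto simp: true_stage_def looks_true_def)

section \<open>Deciding the halting set from a decomposition\<close>

text \<open>A hit certifies a true stage of rank above e. Only oracle queries, bounded quantifiers
  and recursive functions occur, so the decidability rules apply directly.\<close>

definition search ::
    "(nat \<Rightarrow> nat \<rightharpoonup> nat) \<Rightarrow> nat \<Rightarrow> nat \<Rightarrow> nat \<Rightarrow> nat \<Rightarrow> bool" where
  "search P e x N a \<longleftrightarrow>
    (\<forall>y<Suc x. \<exists>i<Suc N. prod_encode (0, prod_encode (i, y)) \<in> join_graphs 2 P \<or>
      prod_encode (1, prod_encode (i, y)) \<in> join_graphs 2 P) \<and>
    prod_encode (1, prod_encode (Suc N, a)) \<in> join_graphs 2 P \<and>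
    looks_true (stage x) (stage a) \<and> e < rank (stage x)"

lemma mem_join_graphs:
  "prod_encode (j, prod_encode (i, x)) \<in> join_graphs r P \<longleftrightarrow> j < r \<and> P j i = Some x"
  by (auto simp: join_graphs_def)

lemma search_iff:
  "search P e x N a \<longleftrightarrow> (\<forall>y\<le>x. \<exists>i\<le>N. P 0 i = Some y \<or> P 1 i = Some y) \<and>
    P 1 (Suc N) = Some a \<and> looks_true (stage x) (stage a) \<and> e < rank (stage x)"
  by (simp add: search_def mem_join_graphs less_Suc_eq_le)

lemma search_sound:
  assumes "path_decomposition 2 coloring P" "search P e x N a"
  shows "true_stage (stage x)" "e < rank (stage x)"
  using assms(2) true_stage_iff_red[OF assms(1)] unfolding search_iff by blast+

lemma search_exists:
  assumes P: "path_decomposition 2 coloring P"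
  shows "\<exists>x N a. search P e x N a"
proof -
  obtain s where s: "true_stage s" "e < rank s" "s \<ge> 1" using true_stage_exists by blast
  then obtain n where n: "s = Suc n" by (metis One_nat_def Suc_le_D)
  \<comment> \<open>This is the first vertex of stage n + 1 = s.\<close>
  let ?x = "3 ^ n :: nat"
  have "\<exists>i. P 0 i = Some y \<or> P 1 i = Some y" for y
  proof -
    have "y \<in> ran (P 0) \<or> y \<in> ran (P 1)"
      using P unfolding path_decomposition_def by (auto simp: less_2_cases_iff)
    then show ?thesis by (auto simp: ran_def)
  qed
  then obtain i where i: "\<And>y. P 0 (i y) = Some y \<or> P 1 (i y) = Some y" by metis
  \<comment> \<open>All numbers up to \<open>?x\<close> appear on one of the paths by this
    position.\<close>
  let ?N = "Max (i ` {..?x})"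
  have listed: "\<forall>y\<le>?x. \<exists>j\<le>?N. P 0 j = Some y \<or> P 1 j = Some y"
    using i by (auto intro!: exI[of _ "i _"] Max_ge)
  have "is_path coloring 1 (P 1)" using P unfolding path_decomposition_def by auto
  then have "dom (P 1) = UNIV" using infinite_red[OF P] by (rule dom_infinite_path)
  then obtain a where a: "P 1 (Suc ?N) = Some a" by (metis UNIV_I domD)
  have "looks_true (stage ?x) (stage a)"
    using true_stage_iff_red[OF P listed a] s(1) n by (simp add: stage_power)
  with listed a s(2) n have "search P e ?x ?N a" unfolding search_iff by (simp add: stage_power)
  then show ?thesis by blast
qed

lemma halting_set_reducible:
  assumes P: "path_decomposition 2 coloring P"
  shows "halting_set \<le>\<^sub>T join_graphs 2 P"
proof -
  let ?A = "join_graphs 2 P"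
  let ?found = "\<lambda>e z. search P e (pfst z) (pfst (psnd z)) (psnd (psnd z))"
  \<comment> \<open>The least code of a successful triple; it exists for every e, so the unbounded
    search is total.\<close>
  let ?z = "\<lambda>e. LEAST z. ?found e z"
  let ?H = "\<lambda>e. \<exists>u<Suc (stage (pfst (?z e))). enumerates u \<and> pfst u = e"
  have ex: "\<exists>z. ?found e z" for e
  proof -
    obtain x N a where "search P e x N a" using search_exists[OF P] by blast
    then have "?found e (prod_encode (x, prod_encode (N, a)))" by simp
    then show ?thesis ..
  qed
  have "decidable_in ?A (\<lambda>y. ?found (pfst y) (psnd y))"
    unfolding search_def by (intro recursive_intros)
  then have z: "recursive_in ?A ?z" using ex by (rule recursive_in_Least)
  have "decidable_in ?A ?H" by (intro recursive_intros z)
  moreover have "e \<in> halting_set \<longleftrightarrow> ?H e" for e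
    by (intro halting_set_iff_true_stage search_sound[OF P LeastI_ex[OF ex]])
  ultimately show ?thesis
    unfolding turing_reducible_def decidable_in_def recursive_in_def by simp
qed

theorem theorem2:
  shows "\<exists>c. is_coloring 2 c \<and> computable_coloring c \<and> stable_coloring c \<and>
    (\<forall>P. path_decomposition 2 c P \<longrightarrow> halting_set \<le>\<^sub>T join_graphs 2 P)"
  using is_coloring_coloring computable_coloring_coloring stable_coloring_coloring
    halting_set_reducible by blast

end
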